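(* For every natural number $n\ge1$, the Chebyshev polynomial of the first kind satisfies $$T_n(x)=\frac{x^{\delta(n)}\;\Omega_0(\lfloor n/2\rfloor\,|\,1,\,2-4x^2\,|\,n)}{2^{\delta(n-1)}\,(n-1)(n-2)\cdots(n-\lfloor n/2\rfloor)} .$$
   Context: For a natural number $m$, $\delta(m)\in\{0,1\}$ denotes $m\bmod 2$. Empty products equal $1$. The Chebyshev polynomials of the first kind are $T_0(x)=1$, $T_1(x)=x$, $T_{n+1}(x)=2x\,T_n(x)-T_{n-1}(x)$. The Quanta Prime Sequence $\Omega_r(k|\zeta,\xi|n)$ associated with $n$ and a point $(\zeta,\xi)\ne(0,0)$ is defined for integers $r,k\ge0$ with $r+k\le\lfloor n/2\rfloor$ by $\Omega_r(0|\zeta,\xi|n)=1$ for all $r$, and for $k\ge1$ $$\Omega_r(k|\zeta,\xi|n)=(2\zeta-\xi)(n-r-k)\,\Omega_r(k-1|\zeta,\xi|n)-2\zeta\,(n-2r-\delta(n-1))\,\Omega_{r+1}(k-1|\zeta,\xi|n).$$ Here it is applied with $(\zeta,\xi)=(1,2-4x^2)$, giving a polynomial in $x$. *)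

theory Defs
  imports Complex_Main "HOL-Computational_Algebra.Polynomial"
begin

definition delta :: "nat \<Rightarrow> nat" where
  "delta m = m mod 2"

text \<open>
  Only the values with \<open>r + k \<le> n div 2\<close> are meaningful; the recursion does not leave this range,
  where the case \<open>k \<ge> 1\<close> forces \<open>n \<ge> 2\<close>, so that the truncated \<open>n - 1\<close> is the true difference.
  The coefficients are subtracted in the ring, not in \<^typ>\<open>nat\<close>.
\<close>

fun Omega :: "nat \<Rightarrow> nat \<Rightarrow> 'a::comm_ring_1 \<Rightarrow> 'a \<Rightarrow> nat \<Rightarrow> 'a" where
  "Omega r 0 \<zeta> \<xi> n = 1"
| "Omega r (Suc k) \<zeta> \<xi> n =
     (2 * \<zeta> - \<xi>) * (of_nat n - of_nat r - of_nat (Suc k)) * Omega r k \<zeta> \<xi> n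
     - 2 * \<zeta> * (of_nat n - 2 * of_nat r - of_nat (delta (n - 1))) * Omega (Suc r) k \<zeta> \<xi> n"

fun Chebyshev_T :: "nat \<Rightarrow> 'a::comm_ring_1 poly" where
  "Chebyshev_T 0 = 1"
| "Chebyshev_T (Suc 0) = [:0, 1:]"
| "Chebyshev_T (Suc (Suc n)) = 2 * [:0, 1:] * Chebyshev_T (Suc n) - Chebyshev_T n"

end

theory Submission
  imports Defs
begin

text \<open>
  Unfold the recursion of \<open>Omega r k\<close> into a sum over lattice paths. A step keeping \<open>r\<close> lowers
  \<open>r + k\<close> by one and a step raising \<open>r\<close> preserves it, so the weight of a path depends only on the
  number \<open>j\<close> of steps raising \<open>r\<close>; hence \<open>Omega r k\<close> is a binomial sum of explicit products.
  On the other side, \<open>2 * T\<^sub>n(x)\<close> expands in powers of \<open>2 * x\<close> with the Lucas triangle as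
  coefficients. Both families of coefficients have the same ratio of consecutive terms.
\<close>

text \<open>Pascal's rule under a sum. In the closed form of \<open>Omega\<close> the two sums
  collect the paths whose first step keeps \<open>r\<close> and those whose first step raises
  it.\<close>

lemma sum_binomial_Suc:
  fixes f :: "nat \<Rightarrow> 'a::comm_semiring_1"
  shows "(\<Sum>j\<le>Suc k. of_nat (Suc k choose j) * f j) =
    (\<Sum>j\<le>k. of_nat (k choose j) * f j) + (\<Sum>j\<le>k. of_nat (k choose j) * f (Suc j))"
proof -
  have "(\<Sum>j\<le>Suc k. of_nat (Suc k choose j) * f j) =
      (f 0 + (\<Sum>j\<le>k. of_nat (k choose Suc j) * f (Suc j)))
      + (\<Sum>j\<le>k. of_nat (k choose j) * f (Suc j))"
    unfolding sum.atMost_Suc_shift by (simp add: distrib_right sum.distrib add_ac)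
  also have "f 0 + (\<Sum>j\<le>k. of_nat (k choose Suc j) * f (Suc j)) =
      (\<Sum>j\<le>Suc k. of_nat (k choose j) * f j)"
    unfolding sum.atMost_Suc_shift by simp
  also have "\<dots> = (\<Sum>j\<le>k. of_nat (k choose j) * f j)"
    by (simp add: binomial_eq_0)
  finally show ?thesis .
qed

text \<open>The \<open>j\<close> raising steps start from \<open>r\<close>, \<open>r + 1\<close>,
  ..., which gives the first product. The \<open>k - j\<close> keeping steps meet
  \<open>r + k\<close>, \<open>r + k - 1\<close>, ... as the sum of the two indices, which gives the
  second.\<close>

lemma Omega_closed_form:
  fixes \<zeta> \<xi> :: "'a::comm_ring_1"
  shows "Omega r k \<zeta> \<xi> n = (\<Sum>j\<le>k. of_nat (k choose j) *
    ((2 * \<zeta> - \<xi>) ^ (k - j) * (- 2 * \<zeta>) ^ j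
      * (\<Prod>i<j. of_nat n - 2 * of_nat r - of_nat (delta (n - 1)) - 2 * of_nat i)
      * (\<Prod>i<k - j. of_nat n - of_nat r - of_nat k + of_nat i)))"
proof (induction k arbitrary: r)
  case 0
  show ?case by simp
next
  case (Suc k)
  let ?f = "\<lambda>r k j. (2 * \<zeta> - \<xi>) ^ (k - j) * (- 2 * \<zeta>) ^ j
      * (\<Prod>i<j. of_nat n - 2 * of_nat r - of_nat (delta (n - 1)) - 2 * of_nat i)
      * (\<Prod>i<k - j. of_nat n - of_nat r - of_nat k + of_nat i) :: 'a"
  \<comment> \<open>Prepending a step to a path splits off the factor \<open>i = 0\<close>: of the
    second product here, of the first product in \<open>raise\<close>.\<close>
  have stay: "?f r (Suc k) j =
      (2 * \<zeta> - \<xi>) * (of_nat n - of_nat r - of_nat (Suc k)) * ?f r k j" if "j \<le> k" for j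
    using that by (simp add: Suc_diff_le prod.lessThan_Suc_shift algebra_simps del: prod.lessThan_Suc)
  have raise: "?f r (Suc k) (Suc j) =
      - (2 * \<zeta> * (of_nat n - 2 * of_nat r - of_nat (delta (n - 1)))) * ?f (Suc r) k j" for j
    by (simp add: prod.lessThan_Suc_shift algebra_simps del: prod.lessThan_Suc)
  have "(\<Sum>j\<le>k. of_nat (k choose j) * ?f r (Suc k) j) =
      (2 * \<zeta> - \<xi>) * (of_nat n - of_nat r - of_nat (Suc k)) * Omega r k \<zeta> \<xi> n"
    unfolding Suc.IH sum_distrib_left by (rule sum.cong[OF refl], subst stay) (simp_all only: atMost_iff mult_ac)
  moreover have "(\<Sum>j\<le>k. of_nat (k choose j) * ?f r (Suc k) (Suc j)) =
      - (2 * \<zeta> * (of_nat n - 2 * of_nat r - of_nat (delta (n - 1)))) * Omega (Suc r) k \<zeta> \<xi> n"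
    unfolding Suc.IH sum_distrib_left raise by (simp only: mult_ac)
  ultimately show ?case
    unfolding Omega.simps sum_binomial_Suc by (simp only: mult_minus_left diff_conv_add_uminus)
qed

text \<open>For n \<ge> 3 the entry counts the matchings with \<open>j\<close> edges in a cycle of
  length \<open>n\<close>. The corner 2 matches 2 T_0 = 2.\<close>

fun lucas_triangle :: "nat \<Rightarrow> nat \<Rightarrow> nat" where
  "lucas_triangle 0 0 = 2"
| "lucas_triangle (Suc n) 0 = 1"
| "lucas_triangle 0 (Suc j) = 0"
| "lucas_triangle (Suc 0) (Suc j) = 0"
| "lucas_triangle (Suc (Suc n)) (Suc j) = lucas_triangle (Suc n) (Suc j) + lucas_triangle n j"

lemma lucas_triangle_eq_0: "n < 2 * j \<Longrightarrow> lucas_triangle n j = 0"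
  by (induction n j rule: lucas_triangle.induct) auto

text \<open>Fix an edge of the cycle: a matching avoiding it lives on a path with all the vertices,
  one using it on a path with two fewer. The proof instead applies Pascal's rule to both binomials;
  since the recurrence reaches back two rows, the induction is strong.\<close>

lemma lucas_triangle_binomial:
  "j \<le> n \<Longrightarrow> lucas_triangle (Suc (Suc n)) (Suc j) = (Suc n - j choose Suc j) + (n - j choose j)"
proof (induction n arbitrary: j rule: less_induct)
  case (less n)
  show ?case
  proof (cases "j = n")
    case True
    then show ?thesis
      by (cases n) (auto simp: lucas_triangle_eq_0)
  next
    case False
    then obtain m where n: "n = Suc m" and "j \<le> m"
      using less.prems by (cases n) auto
    show ?thesis
    proof (cases j)
      case 0
      then show ?thesis using less.IH[of m 0] n by simp
    next
      case (Suc i)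
      then obtain l where m: "m = Suc l" and "i \<le> l"
        using \<open>j \<le> m\<close> by (cases m) auto
      then show ?thesis
        using less.IH[of m j] less.IH[of l i] n Suc \<open>j \<le> m\<close> by (simp add: Suc_diff_le)
    qed
  qed
qed

lemma lucas_triangle_times:
  assumes "2 * j \<le> n"
  shows "(n - j) * lucas_triangle n j = n * (n - j choose j)"
proof (cases j)
  case 0
  then show ?thesis by (cases n) auto
next
  case (Suc i)
  define m where "m = n - 2"
  have n: "n = Suc (Suc m)" and "i \<le> m" using assms Suc by (auto simp: m_def)
  obtain l where m: "m = i + l" using \<open>i \<le> m\<close> le_Suc_ex by blast
  \<comment> \<open>With \<open>l + 1\<close> = n - j and \<open>i + 1\<close> = j, splitting n as
    (n - j) + j reduces the claim to this absorption identity.\<close>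
  have "(i + 1) * (Suc l choose Suc i) = (l + 1) * (l choose i)"
    using Suc_times_binomial[of i l] by simp
  moreover have "lucas_triangle n j = (Suc l choose Suc i) + (l choose i)"
    using lucas_triangle_binomial[OF \<open>i \<le> m\<close>] n Suc m by simp
  moreover have "n - j = l + 1" "n = (l + 1) + (i + 1)"
    using n Suc m by auto
  ultimately show ?thesis
    using Suc by (simp only: distrib_left distrib_right) (simp add: algebra_simps)
qed

text \<open>Both entries reduce, by \<open>lucas_triangle_times\<close> and absorption, to the one
  binomial \<open>c\<close>, n - j - 1 over j. Multiplying by \<open>a + j + 2\<close> = n - j
  avoids division and is cancelled at the end.\<close>

lemma lucas_triangle_ratio:
  assumes "2 * Suc j \<le> n"
  shows "Suc j * (n - Suc j) * lucas_triangle n (Suc j) =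
    (n - 2 * j) * (n - 2 * j - 1) * lucas_triangle n j"
proof -
  define a where "a = n - 2 * Suc j"
  have n: "n = a + 2 * j + 2" using assms by (simp add: a_def)
  define c where "c = (Suc (a + j) choose j)"
  have c1: "Suc j * (Suc (a + j) choose Suc j) = (a + 1) * c"
    using binomial_absorption[of j "Suc (a + j)"] binomial_absorb_comp[of "Suc (a + j)" j]
    by (simp add: c_def)
  have c0: "(a + 2) * (a + j + 2 choose j) = (a + j + 2) * c"
    using binomial_absorb_comp[of "a + j + 2" j] by (simp add: c_def)
  have u0: "(a + j + 2) * lucas_triangle n j = n * (a + j + 2 choose j)"
    using lucas_triangle_times[of j n] n by (simp add: add.commute)
  have u1: "(n - Suc j) * lucas_triangle n (Suc j) = n * (Suc (a + j) choose Suc j)"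
    using lucas_triangle_times[OF assms] n by (simp add: add.commute)
  have "(a + j + 2) * (Suc j * (n - Suc j) * lucas_triangle n (Suc j)) =
      (a + j + 2) * n * (Suc j * (Suc (a + j) choose Suc j))"
    unfolding mult.assoc u1 by (simp only: mult_ac)
  also have "\<dots> = n * (a + 1) * ((a + 2) * (a + j + 2 choose j))"
    unfolding c1 c0 by (simp only: mult_ac)
  also have "\<dots> = (a + 2) * (a + 1) * ((a + j + 2) * lucas_triangle n j)"
    unfolding u0 by (simp only: mult_ac)
  finally have "(a + j + 2) * (Suc j * (n - Suc j) * lucas_triangle n (Suc j)) =
      (a + j + 2) * ((a + 2) * (a + 1) * lucas_triangle n j)"
    by (simp only: mult_ac)
  moreover have "n - 2 * j = a + 2" "n - 2 * j - 1 = a + 1"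
    using n by auto
  ultimately show ?thesis
    by (metis mult_cancel1 add_is_0 zero_neq_numeral)
qed

text \<open>In y = 2x the recurrence reads T_(n+2) = y T_(n+1) - T_n, which is the rule of the
  triangle with alternating signs.\<close>

lemma Chebyshev_T_lucas_triangle:
  fixes x :: "'a::comm_ring_1"
  shows "2 * poly (Chebyshev_T n) x =
    (\<Sum>j\<le>n div 2. (- 1) ^ j * of_nat (lucas_triangle n j) * (2 * x) ^ (n - 2 * j))"
proof -
  let ?t = "\<lambda>n j. (- 1) ^ j * of_nat (lucas_triangle n j) * (2 * x) ^ (n - 2 * j)"
  have extend: "(\<Sum>j\<le>n div 2. ?t n j) = (\<Sum>j\<le>N. ?t n j)" if "n div 2 \<le> N" for n N
  proof (rule sum.mono_neutral_left)
    show "\<forall>j\<in>{..N} - {..n div 2}. ?t n j = 0"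
    proof
      fix j assume "j \<in> {..N} - {..n div 2}"
      then have "n < 2 * j" by auto
      then show "?t n j = 0" by (simp add: lucas_triangle_eq_0)
    qed
  qed (use that in auto)
  show ?thesis
  proof (induction n rule: Chebyshev_T.induct)
    case (3 n)
    let ?m = "n div 2"
    have step: "?t (Suc (Suc n)) (Suc j) = 2 * x * ?t (Suc n) (Suc j) - ?t n j" for j
    \<comment> \<open>In the other case the entry of row \<open>Suc n\<close> vanishes, and the two
      remaining terms have the same, possibly truncated, exponent.\<close>
    proof (cases "2 * Suc j \<le> Suc n")
      case True
      then have "Suc (Suc n) - 2 * Suc j = Suc (Suc n - 2 * Suc j)"
        "n - 2 * j = Suc (Suc n - 2 * Suc j)" by auto
      then show ?thesis by (simp add: algebra_simps del: mult_Suc_right)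
    qed (simp add: lucas_triangle_eq_0 algebra_simps)
    have widen: "(\<Sum>j\<le>Suc ?m. ?t (Suc n) j) = (\<Sum>j\<le>Suc n div 2. ?t (Suc n) j)"
      by (rule extend[symmetric]) simp
    have "(\<Sum>j\<le>Suc ?m. ?t (Suc (Suc n)) j) =
        2 * x * (\<Sum>j\<le>Suc ?m. ?t (Suc n) j) - (\<Sum>j\<le>?m. ?t n j)"
      unfolding sum.atMost_Suc_shift step
      by (simp add: sum_subtractf sum_distrib_left algebra_simps)
    also have "\<dots> = 2 * poly (Chebyshev_T (Suc (Suc n))) x"
      unfolding widen 3[symmetric] by (simp add: algebra_simps)
    finally show ?case by simp
  qed auto
qed

lemma Omega_coefficient_eq_lucas_triangle:
  fixes n :: nat
  defines "m \<equiv> n div 2"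
  assumes "n \<ge> 1" "j \<le> m"
  shows "of_nat (m choose j) * 2 ^ j
      * (\<Prod>i<j. of_nat n - of_nat (delta (n - 1)) - 2 * of_nat i)
      * (\<Prod>i<m - j. of_nat n - of_nat m + of_nat i)
    = (of_nat (lucas_triangle n j) * (\<Prod>i<m. of_nat n - of_nat m + of_nat i) :: 'a::field_char_0)"
  using \<open>j \<le> m\<close>
proof (induction j)
  case 0
  then show ?case using \<open>n \<ge> 1\<close> by (cases n) auto
next
  case (Suc j)
  let ?A = "\<lambda>j. \<Prod>i<j. of_nat n - of_nat (delta (n - 1)) - 2 * of_nat i :: 'a"
  let ?B = "\<lambda>j. \<Prod>i<j. of_nat n - of_nat m + of_nat i :: 'a"
  let ?L = "\<lambda>j. of_nat (m choose j) * 2 ^ j * ?A j * ?B (m - j)"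
  let ?c = "of_nat (Suc j * (n - Suc j)) :: 'a"
  have jm: "j < m" "2 * Suc j \<le> n" using Suc.prems by (auto simp: m_def)
  have binom: "of_nat (Suc j) * of_nat (m choose Suc j) = (of_nat (m - j) * of_nat (m choose j) :: 'a)"
    unfolding of_nat_mult[symmetric] binomial_absorb_comp binomial_absorption ..
  have B: "?B (m - j) = ?B (m - Suc j) * of_nat (n - Suc j)"
  proof -
    have "m - j = Suc (m - Suc j)" using jm by simp
    then show ?thesis using jm by (simp add: of_nat_diff)
  qed
  \<comment> \<open>Of the consecutive numbers n - 2j and n - 2j - 1, the even one is 2(m - j); the
    term \<open>delta (n - 1)\<close> turns the other factor into the odd one.\<close>
  have parity: "2 * of_nat (m - j) * (of_nat n - of_nat (delta (n - 1)) - 2 * of_nat j) =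
      (of_nat ((n - 2 * j) * (n - 2 * j - 1)) :: 'a)"
  proof (cases "even n")
    case True
    obtain l where l: "m = Suc (j + l)" using jm(1) less_imp_Suc_add by blast
    have "n = 2 * m" using True by (simp add: m_def)
    moreover have "delta (n - 1) = 1" using True \<open>n \<ge> 1\<close> unfolding delta_def by presburger
    ultimately show ?thesis using l by (simp add: algebra_simps)
  next
    case False
    obtain l where l: "m = Suc (j + l)" using jm(1) less_imp_Suc_add by blast
    have "n = 2 * m + 1" using False by (simp add: m_def)
    moreover have "delta (n - 1) = 0" using False by (auto simp: delta_def)
    ultimately show ?thesis using l by (simp add: algebra_simps)
  qed
  have "?c * ?L (Suc j) = (of_nat (Suc j) * of_nat (m choose Suc j)) * 2 ^ j
      * ?A j * (2 * (of_nat n - of_nat (delta (n - 1)) - 2 * of_nat j))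
      * (?B (m - Suc j) * of_nat (n - Suc j))"
    by (simp only: prod.lessThan_Suc power_Suc of_nat_mult mult_ac)
  also have "\<dots> = (2 * of_nat (m - j) * (of_nat n - of_nat (delta (n - 1)) - 2 * of_nat j)) * ?L j"
    unfolding binom B[symmetric] by (simp add: mult_ac)
  also have "\<dots> = of_nat ((n - 2 * j) * (n - 2 * j - 1) * lucas_triangle n j) * ?B m"
    unfolding parity using Suc by simp
  also have "\<dots> = ?c * (of_nat (lucas_triangle n (Suc j)) * ?B m)"
    unfolding lucas_triangle_ratio[OF jm(2), symmetric] by simp
  finally have "?c * ?L (Suc j) = ?c * (of_nat (lucas_triangle n (Suc j)) * ?B m)" .
  moreover have "?c \<noteq> 0"
    unfolding of_nat_eq_0_iff using jm by simp
  ultimately show ?case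
    unfolding mult_cancel_left by blast
qed

theorem theorem45:
  fixes n :: nat and x :: "'a::field_char_0"
  assumes "n \<ge> 1"
  shows "poly (Chebyshev_T n) x =
    x ^ delta n * Omega 0 (n div 2) 1 (2 - 4 * x\<^sup>2) n
    / (2 ^ delta (n - 1) * (\<Prod>j = 1..n div 2. of_nat n - of_nat j))"
proof -
  define m where "m = n div 2"
  let ?P = "\<Prod>i<m. of_nat n - of_nat m + of_nat i :: 'a"
  have P: "(\<Prod>j = 1..m. of_nat n - of_nat j) = ?P"
    by (rule prod.reindex_bij_witness[of _ "\<lambda>i. m - i" "\<lambda>j. m - j"]) (auto simp: of_nat_diff)
  have "?P \<noteq> 0"
  proof -
    have "(of_nat n - of_nat j :: 'a) \<noteq> 0" if "j \<in> {1..m}" for j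
      using that assms by (auto simp: m_def)
    then show ?thesis unfolding P[symmetric] by simp
  qed
  have n: "n = 2 * m + delta n"
    by (simp add: m_def delta_def)
  have delta: "delta n = 0 \<and> delta (n - 1) = 1 \<or> delta n = 1 \<and> delta (n - 1) = 0"
    using assms unfolding delta_def by presburger
  \<comment> \<open>At this point 2\<zeta> - \<xi> = (2x)^2, so the sum has only even powers of 2x;
    the extra factor restores the parity of n.\<close>
  have "(2 * x) ^ delta n * Omega 0 m 1 (2 - 4 * x\<^sup>2) n =
      (\<Sum>j\<le>m. (2 * x) ^ delta n * ((2 * x) ^ (2 * (m - j)) * (- 1) ^ j * (of_nat (m choose j) * 2 ^ j
        * (\<Prod>i<j. of_nat n - of_nat (delta (n - 1)) - 2 * of_nat i)
        * (\<Prod>i<m - j. of_nat n - of_nat m + of_nat i))))"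
  proof -
    have "(2 * 1 - (2 - 4 * x\<^sup>2)) = (2 * x)\<^sup>2" by (simp add: power2_eq_square)
    moreover have "(- 2 * 1 :: 'a) ^ j = (- 1) ^ j * 2 ^ j" for j
      by (simp add: power_mult_distrib[symmetric])
    ultimately show ?thesis
      unfolding Omega_closed_form sum_distrib_left power_mult by (simp add: mult_ac)
  qed
  also have "\<dots> = (\<Sum>j\<le>m. ((- 1) ^ j * of_nat (lucas_triangle n j) * (2 * x) ^ (n - 2 * j)) * ?P)"
  proof (rule sum.cong[OF refl])
    fix j assume "j \<in> {..m}"
    then have "j \<le> m" by simp
    then have "n - 2 * j = delta n + 2 * (m - j)" using n by linarith
    then show "(2 * x) ^ delta n * ((2 * x) ^ (2 * (m - j)) * (- 1) ^ j * (of_nat (m choose j) * 2 ^ j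
        * (\<Prod>i<j. of_nat n - of_nat (delta (n - 1)) - 2 * of_nat i)
        * (\<Prod>i<m - j. of_nat n - of_nat m + of_nat i))) =
        ((- 1) ^ j * of_nat (lucas_triangle n j) * (2 * x) ^ (n - 2 * j)) * ?P"
      using Omega_coefficient_eq_lucas_triangle[where ?'a='a, OF assms, of j] \<open>j \<le> m\<close>
      unfolding m_def[symmetric] by (simp add: power_add mult_ac)
  qed
  also have "\<dots> = 2 * poly (Chebyshev_T n) x * ?P"
    unfolding Chebyshev_T_lucas_triangle sum_distrib_right m_def ..
  finally have main: "(2 * x) ^ delta n * Omega 0 m 1 (2 - 4 * x\<^sup>2) n = 2 * poly (Chebyshev_T n) x * ?P" .
  \<comment> \<open>Since \<open>delta n + delta (n - 1)\<close> = 1, cancelling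
    \<open>2 ^ delta n\<close> against the factor 2 leaves \<open>2 ^ delta (n - 1)\<close>.\<close>
  from delta show ?thesis
    unfolding m_def[symmetric] P using main \<open>?P \<noteq> 0\<close>
    by (elim disjE conjE) (simp_all add: field_simps)
qed

end
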